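(* Let $u$ be an eigenfunction of $-\Delta$ on $K$, and let $f:[0,1]\to\mathbb{R}$ be its restriction to the central horizontal circle $C\subset K$, expressed as a function of the parameter $t\in[0,1]$ of $C$. Then $f$ is Lipschitz continuous, i.e. there is a constant $M$ with $|f(s)-f(t)|\le M|s-t|$ for all $s,t\in[0,1]$.
   Context: Identify the circle with $\mathbb{R}/\mathbb{Z}$ (so $0=1$). For $m\ge 0$ consider the $2\cdot 5^m$ points $\frac{n}{2\cdot 5^m}$, $1\le n\le 2\cdot 5^m$. Each such $n$ is uniquely $n=5^k(a+5j)$ with $k,j\ge 0$ integers and $a\in\{1,2,3,4\}$. Identify these points in pairs by $$\frac{5^k(1+5j)}{2\cdot 5^m}\sim\frac{5^k(2+5j)}{2\cdot 5^m},\qquad \frac{5^k(3+5j)}{2\cdot 5^m}\sim\frac{5^k(4+5j)}{2\cdot 5^m}$$ (for example $\frac12\sim 1$). These identifications are consistent for different $m$. The graph $K_m$ has as vertices the $5^m$ identified pairs, and as edges the arcs joining consecutive points of the form $\frac{n}{2\cdot5^m}$ on the circle (loops may occur). Functions on $K_m$ are real functions $u$ on these points with $u(x)=u(y)$ whenever $x\sim y$. For a vertex $x\sim y$ let $N_m(x)$ be the list (with multiplicity) of the four points $x\pm\frac{1}{2\cdot5^m}$, $y\pm\frac1{2\cdot5^m}$. The Laplacian on $K_m$ is $$-\Delta_m u(x)=\sum_{z\in N_m(x)}(u(x)-u(z)).$$ $K$ (the Vicsek set with no loose ends) is the circle $\mathbb{R}/\mathbb{Z}$ with the identifications $\frac{5^k(1+5j)}{2\cdot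 5^m}\sim\frac{5^k(2+5j)}{2\cdot 5^m}$ and $\frac{5^k(3+5j)}{2\cdot 5^m}\sim\frac{5^k(4+5j)}{2\cdot 5^m}$ (integers $k,j\ge0$, numerators between $1$ and $2\cdot5^m$) made for all $m\ge0$; a continuous function on $K$ is a continuous function $u:\mathbb{R}/\mathbb{Z}\to\mathbb{R}$ with $u(x)=u(y)$ for all identified pairs $x\sim y$ of all levels. A continuous function $u$ on $K$ belongs to $\operatorname{dom}\Delta$ with $\Delta u=f$, where $f$ is a continuous function on $K$, if $\sup_{x\in K_m}|15^m\Delta_m (u|_{K_m})(x)-f(x)|\to0$ as $m\to\infty$ (supremum over vertices $x$ of $K_m$). An eigenfunction of $-\Delta$ with eigenvalue $\lambda$ is a nonzero $u\in\operatorname{dom}\Delta$ with $-\Delta u=\lambda u$. The central horizontal circle $C\subset K$ corresponds to the Cantor set in $[0,\frac12]$ obtained by deleting $(\frac1{10},\frac2{10})$ and $(\frac3{10},\frac4{10})$ from $[0,\frac12]$ and iterating the same (scaled) procedure on each remaining interval. It is parametrized by $t\in[0,1]$ so that $0\le t\le\frac13$ parametrizes $0\le x\le\frac1{10}$, $\frac13\le t\le\frac23$ parametrizes $\frac2{10}\le x\le\frac3{10}$, $\frac23\le t\le1$ parametrizes $\frac4{10}\le x\le\frac5{10}$, and so on iteratively. Explicitly, $t=\sum_{i\ge1}d_i3^{-i}$ with $d_i\in\{0,1,2\}$ corresponds to the point $x(t)=\sum_{i\ge1}d_i5^{-i}$, and the restriction of $u$ to $C$ is $f(t)=u(x(t))$.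 (If $t$ has two ternary expansions the two resulting points are identified in $K$, so $f$ is well defined; also $t=0$ and $t=1$ correspond to the identified points $0$ and $\frac12$.) The vertices of $K_m$ lying on $C$ correspond, in consecutive order, to $t=\frac{k}{3^m}$, $0\le k\le3^m$. *)

theory Defs
  imports "HOL-Analysis.Analysis"
begin

text \<open>
  Functions on the circle \<open>\<real>/\<int>\<close> are represented by 1-periodic functions on \<open>\<real>\<close>.
  The points \<open>n / (2 * 5^m)\<close> of level \<open>m\<close> are named by their numerators \<open>n\<close> in \<open>{1..2 * 5^m}\<close>.
\<close>

definition vpoint :: "nat \<Rightarrow> nat \<Rightarrow> real" where
  "vpoint m n = real n / (2 * 5 ^ m)"

text \<open>
  The pairs are ordered (\<open>a = 1\<close> before \<open>a = 2\<close>, and \<open>a = 3\<close> before \<open>a = 4\<close>), so that every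
  vertex of \<open>K\<^sub>m\<close> occurs exactly once.
\<close>

definition vertices :: "nat \<Rightarrow> (nat \<times> nat) set" where
  "vertices m = {(p, q). p \<in> {1..2 * 5 ^ m} \<and> q \<in> {1..2 * 5 ^ m} \<and>
     (\<exists>k j. p = 5 ^ k * (1 + 5 * j) \<and> q = 5 ^ k * (2 + 5 * j) \<or>
            p = 5 ^ k * (3 + 5 * j) \<and> q = 5 ^ k * (4 + 5 * j))}"

text \<open>\<open>N\<^sub>m\<close>, with multiplicity; the points are to be read modulo 1.\<close>

definition neighbours :: "nat \<Rightarrow> nat \<times> nat \<Rightarrow> real list" where
  "neighbours m = (\<lambda>(p, q). let h = 1 / (2 * 5 ^ m) in
     [vpoint m p + h, vpoint m p - h, vpoint m q + h, vpoint m q - h])"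

text \<open>
  The value of a function at a vertex is its value at the first of the two identified points;
  for functions on \<open>K\<close> the choice is irrelevant.
\<close>

definition graph_laplacian :: "nat \<Rightarrow> (real \<Rightarrow> real) \<Rightarrow> nat \<times> nat \<Rightarrow> real" where
  "graph_laplacian m u v = - (\<Sum>z \<leftarrow> neighbours m v. u (vpoint m (fst v)) - u z)"

definition continuous_on_K :: "(real \<Rightarrow> real) \<Rightarrow> bool" where
  "continuous_on_K u \<longleftrightarrow> continuous_on UNIV u \<and> (\<forall>x. u (x + 1) = u x) \<and>
     (\<forall>m. \<forall>(p, q) \<in> vertices m. u (vpoint m p) = u (vpoint m q))"

definition has_laplacian :: "(real \<Rightarrow> real) \<Rightarrow> (real \<Rightarrow> real) \<Rightarrow> bool" where
  "has_laplacian u f \<longleftrightarrow> continuous_on_K u \<and> continuous_on_K f \<and>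
     (\<lambda>m. SUP v \<in> vertices m. \<bar>15 ^ m * graph_laplacian m u v - f (vpoint m (fst v))\<bar>)
       \<longlonglongrightarrow> 0"

definition eigenfunction :: "(real \<Rightarrow> real) \<Rightarrow> real \<Rightarrow> bool" where
  "eigenfunction u \<mu> \<longleftrightarrow> (\<exists>x. u x \<noteq> 0) \<and>
     (\<exists>f. has_laplacian u f \<and> (\<forall>x. - f x = \<mu> * u x))"

text \<open>
  \<open>circle_param t\<close> is the point \<open>x(t)\<close> computed from some ternary expansion of \<open>t\<close>; the lemmas
  \<open>ex_ternary\<close> and \<open>restrict_to_C_eq\<close> below show that there always is one, and that the choice
  does not affect the restriction of a function on \<open>K\<close>.
\<close>

definition ternary :: "(nat \<Rightarrow> nat) set" where
  "ternary = {d. \<forall>i. d i \<in> {0, 1, 2}}"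

definition circle_param :: "real \<Rightarrow> real" where
  "circle_param t = (SOME x. \<exists>d \<in> ternary.
     t = (\<Sum>i. real (d i) / 3 ^ Suc i) \<and> x = (\<Sum>i. real (d i) / 5 ^ Suc i))"

definition restrict_to_C :: "(real \<Rightarrow> real) \<Rightarrow> real \<Rightarrow> real" where
  "restrict_to_C u t = u (circle_param t)"

lemma finite_vertices: "finite (vertices m)"
  by (rule finite_subset[of _ "{1..2 * 5 ^ m} \<times> {1..2 * 5 ^ m}"]) (auto simp: vertices_def)

lemma vertices_nonempty: "vertices m \<noteq> {}"
proof -
  have "(5 ^ m, 2 * 5 ^ m) \<in> vertices m"
  proof -
    have "5 ^ m = (5 ^ m :: nat) * (1 + 5 * 0) \<and> 2 * 5 ^ m = (5 ^ m :: nat) * (2 + 5 * 0)"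
      by simp
    then have "\<exists>k j. 5 ^ m = (5 ^ k :: nat) * (1 + 5 * j) \<and> 2 * 5 ^ m = (5 ^ k :: nat) * (2 + 5 * j) \<or>
            5 ^ m = (5 ^ k :: nat) * (3 + 5 * j) \<and> 2 * 5 ^ m = (5 ^ k :: nat) * (4 + 5 * j)"
      by blast
    then show ?thesis by (simp add: vertices_def)
  qed
  then show ?thesis by blast
qed

lemma summable_digits:
  fixes b :: real
  assumes "d \<in> ternary" "b > 1"
  shows "summable (\<lambda>i. real (d i) / b ^ Suc i)"
proof (rule summable_comparison_test')
  show "summable (\<lambda>i. 2 * (1 / b) ^ Suc i)"
    using assms(2) by (intro summable_mult summable_ignore_initial_segment[of _ 1, simplified]
        summable_geometric) auto
  show "norm (real (d i) / b ^ Suc i) \<le> 2 * (1 / b) ^ Suc i" if "i \<ge> 0" for i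
  proof -
    have "real (d i) \<le> 2" using assms(1) by (auto simp: ternary_def dest!: spec[of _ i])
    moreover have "b ^ Suc i > 0" using assms(2) by simp
    ultimately show ?thesis using assms(2) by (simp add: divide_simps power_divide)
  qed
qed

lemma ex_ternary:
  assumes "t \<in> {0..1}"
  shows "\<exists>d \<in> ternary. t = (\<Sum>i. real (d i) / 3 ^ Suc i)"
proof (cases "t = 1")
  case True
  have "(\<lambda>i. (2 / 3) * (1 / 3 :: real) ^ i) sums ((2 / 3) * (1 / (1 - 1 / 3)))"
    by (intro sums_mult geometric_sums) auto
  then have "(\<lambda>i. real 2 / 3 ^ Suc i) sums 1"
    by (simp add: power_divide)
  then have "t = (\<Sum>i. real 2 / 3 ^ Suc i)" using True by (metis sums_unique)
  then show ?thesis by (intro bexI[of _ "\<lambda>_. 2"]) (auto simp: ternary_def)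
next
  case False
  define g where "g n = nat \<lfloor>3 ^ n * t\<rfloor>" for n :: nat
  define d where "d i = g (Suc i) - 3 * g i" for i
  have g: "real (g n) \<le> 3 ^ n * t" "3 ^ n * t < real (g n) + 1" for n
  proof -
    have "0 \<le> 3 ^ n * t" using assms by simp
    then show "real (g n) \<le> 3 ^ n * t" "3 ^ n * t < real (g n) + 1"
      unfolding g_def by linarith+
  qed
  have step: "3 * g i \<le> g (Suc i) \<and> g (Suc i) \<le> 3 * g i + 2" for i
  proof -
    have "real (3 * g i) < real (g (Suc i) + 1)" "real (g (Suc i)) < real (3 * g i + 3)"
      using g[of i] g[of "Suc i"] by simp_all
    then show ?thesis unfolding of_nat_less_iff by linarith
  qed
  have dT: "d \<in> ternary"
  proof -
    have "d i \<le> 2" for i using step[of i] unfolding d_def by linarith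
    then have "d i = 0 \<or> d i = 1 \<or> d i = 2" for i
      by (metis One_nat_def le_0_eq le_Suc_eq numeral_2_eq_2)
    then show ?thesis by (auto simp: ternary_def)
  qed
  have g0: "g 0 = 0"
    using g(1)[of 0] assms False by simp
  have part: "(\<Sum>i<n. real (d i) / 3 ^ Suc i) = real (g n) / 3 ^ n" for n
  proof (induction n)
    case 0 show ?case by (simp add: g0)
  next
    case (Suc n)
    have "real (d n) = real (g (Suc n)) - 3 * real (g n)"
      using step[of n] by (simp add: d_def of_nat_diff)
    then show ?case using Suc by (simp add: field_simps)
  qed
  have "(\<lambda>n. real (g n) / 3 ^ n) \<longlonglongrightarrow> t"
  proof (rule tendsto_sandwich)
    show "\<forall>\<^sub>F n in sequentially. t - (1 / 3) ^ n \<le> real (g n) / 3 ^ n"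
    proof (intro always_eventually allI)
      fix n
      have "t \<le> (real (g n) + 1) / 3 ^ n"
        using g(2)[of n] by (simp add: pos_le_divide_eq mult.commute less_imp_le)
      then show "t - (1 / 3) ^ n \<le> real (g n) / 3 ^ n"
        by (simp add: add_divide_distrib power_divide)
    qed
    show "\<forall>\<^sub>F n in sequentially. real (g n) / 3 ^ n \<le> t"
      using g(1) by (intro always_eventually allI) (simp add: field_simps)
    have "(\<lambda>n. t - (1 / 3 :: real) ^ n) \<longlonglongrightarrow> t - 0"
      by (intro tendsto_diff tendsto_const LIMSEQ_realpow_zero) auto
    then show "(\<lambda>n. t - (1 / 3 :: real) ^ n) \<longlonglongrightarrow> t" by simp
  qed auto
  then have "(\<lambda>i. real (d i) / 3 ^ Suc i) sums t"
    unfolding sums_def part .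
  then show ?thesis using dT sums_unique by blast
qed

lemma two_expansions:
  assumes u: "continuous_on_K u" and d: "d \<in> ternary" and e: "e \<in> ternary"
    and eq: "(\<Sum>i. real (d i) / 3 ^ Suc i) = (\<Sum>i. real (e i) / 3 ^ Suc i)"
    and pre: "\<And>i. i < n \<Longrightarrow> d i = e i" and lt: "e n < d n"
  shows "u (\<Sum>i. real (d i) / 5 ^ Suc i) = u (\<Sum>i. real (e i) / 5 ^ Suc i)"
proof -
  define w where "w i = 2 + real (d (i + Suc n)) - real (e (i + Suc n))" for i
  have le2: "d i \<le> 2" "e i \<le> 2" for i
    using d e by (auto simp: ternary_def dest!: spec[of _ i])
  have w0: "w i \<ge> 0" for i using le2(2)[of "i + Suc n"] by (simp add: w_def)
  have split: "(\<Sum>i. real (c i) / b ^ Suc i) =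
      (\<Sum>i. real (c (i + Suc n)) / b ^ Suc (i + Suc n)) + (\<Sum>i<n. real (c i) / b ^ Suc i)
        + real (c n) / b ^ Suc n"
    if "c \<in> ternary" "b > 1" for c and b :: real
    using suminf_split_initial_segment[OF summable_digits[OF that], of "Suc n"] by simp
  have geo: "(\<lambda>i. 2 / b ^ Suc (i + Suc n)) sums (2 / (b - 1) / b ^ Suc n)"
    if "b > 1" for b :: real
  proof -
    have "(\<lambda>i. (2 / b ^ Suc (Suc n)) * (1 / b) ^ i) sums
        ((2 / b ^ Suc (Suc n)) * (1 / (1 - 1 / b)))"
      using that by (intro sums_mult geometric_sums) auto
    moreover have "(2 / b ^ Suc (Suc n)) * (1 / (1 - 1 / b)) = 2 / (b - 1) / b ^ Suc n"
      using that by (simp add: field_simps)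
    moreover have "(\<lambda>i. (2 / b ^ Suc (Suc n)) * (1 / b) ^ i) = (\<lambda>i. 2 / b ^ Suc (i + Suc n))"
      using that by (simp add: fun_eq_iff power_divide power_add mult_ac)
    ultimately show ?thesis by metis
  qed
  have sm: "(\<lambda>i. real (c (i + Suc n)) / b ^ Suc (i + Suc n)) sums
      (\<Sum>i. real (c (i + Suc n)) / b ^ Suc (i + Suc n))"
    if "c \<in> ternary" "b > 1" for c and b :: real
    using summable_ignore_initial_segment[OF summable_digits[OF that], of "Suc n"]
    by (rule summable_sums)
  define Td where "Td = (\<Sum>i. real (d (i + Suc n)) / 3 ^ Suc (i + Suc n))"
  define Te where "Te = (\<Sum>i. real (e (i + Suc n)) / 3 ^ Suc (i + Suc n))"
  have ws: "(\<lambda>i. w i / 3 ^ Suc (i + Suc n)) sums (1 / 3 ^ Suc n + Td - Te)"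
  proof -
    have "(\<lambda>i. 2 / 3 ^ Suc (i + Suc n) + real (d (i + Suc n)) / 3 ^ Suc (i + Suc n)
        - real (e (i + Suc n)) / 3 ^ Suc (i + Suc n)) sums (2 / (3 - 1) / 3 ^ Suc n + Td - Te)"
      unfolding Td_def Te_def using d e by (intro sums_diff sums_add geo sm) auto
    then show ?thesis by (simp add: w_def diff_divide_distrib add_divide_distrib)
  qed
  have presum: "(\<Sum>i<n. real (d i) / b ^ Suc i) = (\<Sum>i<n. real (e i) / b ^ Suc i)"
    for b :: real using pre by (intro sum.cong) auto
  have E: "Td + real (d n) / 3 ^ Suc n = Te + real (e n) / 3 ^ Suc n"
    using eq split[OF d, of 3] split[OF e, of 3] presum[of 3] by (simp add: Td_def Te_def)
  have wpos: "0 \<le> 1 / 3 ^ Suc n + Td - Te"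
    by (rule sums_le[OF _ sums_zero ws]) (use w0 in auto)
  have diff1: "1 / 3 ^ Suc n + Td - Te = (1 + real (e n) - real (d n)) / 3 ^ Suc n"
    using E by (simp add: add_divide_distrib diff_divide_distrib)
  then have "0 \<le> (1 + real (e n) - real (d n)) / 3 ^ Suc n"
    using wpos by metis
  then have "real (d n) \<le> 1 + real (e n)"
    unfolding zero_le_divide_iff using zero_less_power[of "3::real" "Suc n"] by linarith
  then have dn: "d n = Suc (e n)" using lt by linarith
  have wz: "w i = 0" for i
  proof -
    have z: "(\<lambda>i. w i / 3 ^ Suc (i + Suc n)) sums 0"
      using ws diff1 dn by simp
    have "\<forall>i. w i / 3 ^ Suc (i + Suc n) = 0"
      using z w0 by (subst suminf_eq_zero_iff[symmetric]) (auto simp: sums_iff)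
    then show ?thesis by simp
  qed
  have tail: "d (i + Suc n) = 0 \<and> e (i + Suc n) = 2" for i
    using wz[of i] le2(2)[of "i + Suc n"] unfolding w_def by linarith
  define P where "P = (\<Sum>i<n. e i * 5 ^ (n - Suc i))"
  have P: "(\<Sum>i<n. real (e i) / 5 ^ Suc i) = real P / 5 ^ n"
  proof -
    have "real (e i) / 5 ^ Suc i = real (e i * 5 ^ (n - Suc i)) / 5 ^ n" if "i < n" for i
    proof -
      have "(5::real) ^ n = 5 ^ Suc i * 5 ^ (n - Suc i)"
        using that by (metis Suc_leI le_add_diff_inverse power_add)
      then show ?thesis by simp
    qed
    then show ?thesis by (simp add: P_def sum_divide_distrib)
  qed
  have xd: "(\<Sum>i. real (d i) / 5 ^ Suc i) = vpoint (Suc n) (10 * P + 2 * e n + 2)"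
    using split[OF d, of 5] presum[of 5] P tail dn by (simp add: vpoint_def field_simps)
  have "(\<Sum>i. real (e (i + Suc n)) / 5 ^ Suc (i + Suc n)) = 2 / (5 - 1) / 5 ^ Suc n"
    using sums_unique[OF geo[of 5]] tail by simp
  then have xe: "(\<Sum>i. real (e i) / 5 ^ Suc i) = vpoint (Suc n) (10 * P + 2 * e n + 1)"
    using split[OF e, of 5] P by (simp add: vpoint_def field_simps)
  have en: "e n = 0 \<or> e n = 1" using dn le2(1)[of n] by linarith
  have "P + 1 \<le> 5 ^ n"
  proof -
    have "(\<Sum>i<n. 2 * 5 ^ (n - Suc i)) + 1 \<le> (5::nat) ^ n"
    proof -
      have "(\<Sum>i<n. 2 * 5 ^ (n - Suc i)) = (\<Sum>i<n. 2 * 5 ^ i :: nat)"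
        by (rule sum.nat_diff_reindex)
      moreover have "(\<Sum>i<n. 2 * 5 ^ i :: nat) + 1 \<le> 5 ^ n" by (induction n) auto
      ultimately show ?thesis by simp
    qed
    moreover have "P \<le> (\<Sum>i<n. 2 * 5 ^ (n - Suc i))"
      unfolding P_def using le2(2) by (intro sum_mono mult_right_mono) auto
    ultimately show ?thesis by linarith
  qed
  then have "(10 * P + 2 * e n + 1, 10 * P + 2 * e n + 2) \<in> vertices (Suc n)"
    using en unfolding vertices_def mem_Collect_eq case_prod_conv
    by (intro conjI exI[of _ 0] exI[of _ "2 * P"]) auto
  then show ?thesis using u unfolding continuous_on_K_def xd xe by fastforce
qed

lemma restrict_to_C_eq:
  assumes u: "continuous_on_K u" and d: "d \<in> ternary"
  shows "restrict_to_C u (\<Sum>i. real (d i) / 3 ^ Suc i) = u (\<Sum>i. real (d i) / 5 ^ Suc i)"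
proof -
  let ?t = "\<Sum>i. real (d i) / 3 ^ Suc i"
  have "\<exists>e \<in> ternary. ?t = (\<Sum>i. real (e i) / 3 ^ Suc i) \<and>
      circle_param ?t = (\<Sum>i. real (e i) / 5 ^ Suc i)"
    unfolding circle_param_def by (rule someI_ex) (use d in blast)
  then obtain e where e: "e \<in> ternary" "?t = (\<Sum>i. real (e i) / 3 ^ Suc i)"
    "circle_param ?t = (\<Sum>i. real (e i) / 5 ^ Suc i)" by blast
  have "u (\<Sum>i. real (e i) / 5 ^ Suc i) = u (\<Sum>i. real (d i) / 5 ^ Suc i)"
  proof (cases "d = e")
    case False
    define n where "n = (LEAST i. d i \<noteq> e i)"
    have ex: "\<exists>i. d i \<noteq> e i" using False by auto
    have ne: "d n \<noteq> e n" unfolding n_def by (rule LeastI_ex[OF ex])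
    have pre: "d i = e i" if "i < n" for i
      using not_less_Least[of i "\<lambda>i. d i \<noteq> e i"] that unfolding n_def by blast
    consider "e n < d n" | "d n < e n" using ne by linarith
    then show ?thesis
    proof cases
      case 1 then show ?thesis using two_expansions[OF u d e(1) e(2) pre] by simp
    next
      case 2 then show ?thesis using two_expansions[OF u e(1) d e(2)[symmetric], of n] pre by metis
    qed
  qed simp
  then show ?thesis unfolding restrict_to_C_def e(3) .
qed

end

theory Submission
  imports Defs
begin

text \<open>
  The reason for the Lipschitz property is that a continuous, hence bounded, Laplacian keeps the
  suitably rescaled increments of \<open>u\<close> over the arcs of \<open>K\<^sub>m\<close> bounded as \<open>m\<close> grows.

  Consider an arc of level \<open>m\<close> from \<open>a\<close> to \<open>d\<close>. At level \<open>m + 1\<close> it splits into five arcs.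
  Its four interior points are identified in two adjacent pairs, so two of the five arcs become loops
  and the other three form a path \<open>a, b, c, d\<close> whose interior vertices \<open>b\<close> and \<open>c\<close> carry one
  loop each. Loops do not contribute to the graph Laplacian. At \<open>b\<close> and \<open>c\<close> it is therefore the
  second difference of \<open>u\<close> along the path, and by the definition of \<open>\<Delta>\<close> it is at most
  \<open>A / 15^(m+1)\<close> for a constant \<open>A\<close>. Hence the three increments along the path are nearly
  equal: each differs from a third of their sum, the increment of \<open>u\<close> over the old arc,
  by at most \<open>A / 15^(m+1)\<close>.

  Multiplying by \<open>3^(m+1)\<close> shows that the rescaled increments \<open>3^m \<bar>\<delta>\<bar>\<close> grow by at most
  \<open>A / 5^(m+1)\<close> from one level to the next. They vanish at level 0, so the geometric series bounds
  all of them by \<open>A / 4\<close> (lemma \<open>arc_increment_bound\<close>). Each interval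
  \<open>[k / 3^m, (k+1) / 3^m]\<close> of the parameter of \<open>C\<close> corresponds to one arc of level \<open>m\<close>
  (lemma \<open>triadic_interval_is_arc\<close>). So the restriction of \<open>u\<close> satisfies the Lipschitz estimate
  with constant \<open>A / 4\<close> at triadic points of equal level. As \<open>u\<close> is continuous, truncating the
  ternary expansions of \<open>s\<close> and \<open>t\<close> carries the estimate over to all of \<open>[0, 1]\<close>.
\<close>

section \<open>Increments over the arcs of the graphs\<close>

definition arc_increment :: "(real \<Rightarrow> real) \<Rightarrow> nat \<Rightarrow> nat \<Rightarrow> real" where
  "arc_increment u m n = u (vpoint m (Suc n)) - u (vpoint m n)"

lemma vpoint_refine: "vpoint (Suc m) (5 * n) = vpoint m n"
  by (simp add: vpoint_def)

lemma identified:
  assumes "continuous_on_K u" "(p, q) \<in> vertices m"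
  shows "u (vpoint m p) = u (vpoint m q)"
  using assms unfolding continuous_on_K_def by fastforce

text \<open>
  At a vertex formed by two consecutive points the arc between them is a loop, and what
  is left of the Laplacian is a second difference over the two outer arcs.
\<close>

lemma graph_laplacian_consecutive:
  assumes "continuous_on_K u" "(Suc q, Suc (Suc q)) \<in> vertices m"
  shows "graph_laplacian m u (Suc q, Suc (Suc q)) =
    arc_increment u m (Suc (Suc q)) - arc_increment u m q"
proof -
  have plus: "vpoint m n + 1 / (2 * 5 ^ m) = vpoint m (Suc n)" for n
    by (simp add: vpoint_def add_divide_distrib)
  have minus: "vpoint m (Suc n) - 1 / (2 * 5 ^ m) = vpoint m n" for n
    by (simp add: vpoint_def add_divide_distrib)
  show ?thesis
    using identified[OF assms]
    by (simp add: graph_laplacian_def neighbours_def Let_def plus minus arc_increment_def)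
qed

lemma consecutive_vertices:
  assumes "n < 2 * 5 ^ m"
  shows "(5 * n + 1, 5 * n + 2) \<in> vertices (Suc m)"
    and "(5 * n + 3, 5 * n + 4) \<in> vertices (Suc m)"
  using assms unfolding vertices_def mem_Collect_eq case_prod_conv
  by (intro conjI exI[of _ 0] exI[of _ n]; simp)+

text \<open>
  The distances from \<open>15^m \<Delta>\<^sub>m u\<close> to \<open>f\<close> form a convergent, hence bounded sequence in \<open>m\<close>, and
  the continuous function \<open>f\<close> is bounded on \<open>[0, 1]\<close>.
\<close>

lemma has_laplacian_bounded:
  assumes "has_laplacian u f"
  obtains A where "\<And>m v. v \<in> vertices m \<Longrightarrow> 15 ^ m * \<bar>graph_laplacian m u v\<bar> \<le> A"
proof -
  define e where "e m v = \<bar>15 ^ m * graph_laplacian m u v - f (vpoint m (fst v))\<bar>" for m v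
  have "(\<lambda>m. SUP v \<in> vertices m. e m v) \<longlonglongrightarrow> 0"
    using assms unfolding has_laplacian_def e_def by blast
  then obtain B where B: "\<And>m. norm (SUP v \<in> vertices m. e m v) \<le> B"
    by (metis Bseq_def convergent_def convergent_imp_Bseq)
  have eB: "e m v \<le> B" if "v \<in> vertices m" for m v
  proof -
    have "e m v \<le> (SUP v \<in> vertices m. e m v)"
      using that by (intro cSUP_upper) (auto intro: bdd_above_finite simp: finite_vertices)
    then show ?thesis using B[of m] by simp
  qed
  have "continuous_on {0..1} f"
    using assms unfolding has_laplacian_def continuous_on_K_def
    by (meson continuous_on_subset subset_UNIV)
  then have "bounded (f ` {0..1})"
    by (intro compact_imp_bounded compact_continuous_image) auto
  then obtain F where F: "\<And>x. x \<in> {0..1} \<Longrightarrow> \<bar>f x\<bar> \<le> F"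
    unfolding bounded_iff real_norm_def by blast
  have "15 ^ m * \<bar>graph_laplacian m u v\<bar> \<le> B + F" if "v \<in> vertices m" for m v
  proof -
    have "fst v \<le> 2 * 5 ^ m" using that by (auto simp: vertices_def)
    then have "real (fst v) \<le> real (2 * 5 ^ m)" by (rule of_nat_mono)
    then have "vpoint m (fst v) \<in> {0..1}" by (simp add: vpoint_def)
    moreover have "15 ^ m * \<bar>graph_laplacian m u v\<bar> = \<bar>15 ^ m * graph_laplacian m u v\<bar>"
      by (simp add: abs_mult)
    ultimately show ?thesis
      using F[of "vpoint m (fst v)"] eB[OF that] unfolding e_def by linarith
  qed
  then show ?thesis by (rule that)
qed

text \<open>
  This is the refinement step. Of the five arcs inside an arc, those with offset 1 and 3
  are loops, and the increments over the other three add up to the increment over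
  the whole arc. Consecutive ones differ by a value of the Laplacian.
\<close>

lemma arc_increment_refine:
  assumes u: "continuous_on_K u" and n: "n < 2 * 5 ^ m" and r: "r < 5"
    and L: "\<And>v. v \<in> vertices (Suc m) \<Longrightarrow> \<bar>graph_laplacian (Suc m) u v\<bar> \<le> \<epsilon>"
  shows "3 * \<bar>arc_increment u (Suc m) (5 * n + r)\<bar> \<le> \<bar>arc_increment u m n\<bar> + 3 * \<epsilon>"
proof -
  let ?\<delta> = "\<lambda>r. arc_increment u (Suc m) (5 * n + r)"
  note v = consecutive_vertices[OF n]
  have loops: "?\<delta> 1 = 0" "?\<delta> 3 = 0"
    using identified[OF u v(1)] identified[OF u v(2)]
    by (simp_all add: arc_increment_def eval_nat_numeral)
  have second: "\<bar>?\<delta> 2 - ?\<delta> 0\<bar> \<le> \<epsilon>" "\<bar>?\<delta> 4 - ?\<delta> 2\<bar> \<le> \<epsilon>"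
    using L[OF v(1)] L[OF v(2)] v
      graph_laplacian_consecutive[OF u, of "5 * n" "Suc m"]
      graph_laplacian_consecutive[OF u, of "5 * n + 2" "Suc m"]
    by (simp_all add: eval_nat_numeral)
  have "arc_increment u m n = ?\<delta> 0 + ?\<delta> 1 + ?\<delta> 2 + ?\<delta> 3 + ?\<delta> 4"
    using vpoint_refine[of m n] vpoint_refine[of m "Suc n"]
    by (simp add: arc_increment_def eval_nat_numeral)
  moreover have "r \<in> {0, 1, 2, 3, 4}" using r by auto
  ultimately show ?thesis using loops second by auto
qed

text \<open>
  The factor \<open>1 - 1 / 5^m\<close> records the partial sums of \<open>\<Sum>i\<ge>1. A / 5^i = A / 4\<close>. The induction
  starts from 0 because \<open>K\<^sub>0\<close> has a single vertex.
\<close>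

lemma arc_increment_bound:
  assumes u: "continuous_on_K u"
    and A: "\<And>m v. v \<in> vertices m \<Longrightarrow> 15 ^ m * \<bar>graph_laplacian m u v\<bar> \<le> A"
    and "n < 2 * 5 ^ m"
  shows "3 ^ m * \<bar>arc_increment u m n\<bar> \<le> A / 4 * (1 - 1 / 5 ^ m)"
  using assms(3)
proof (induction m arbitrary: n)
  case 0
  have "(1, 2) \<in> vertices 0"
    unfolding vertices_def by (auto intro!: exI[of _ 0])
  then have "u (1 / 2) = u 1" using identified[OF u] by (force simp: vpoint_def)
  moreover have "u 1 = u 0" using u unfolding continuous_on_K_def by (metis add_0)
  moreover have "n = 0 \<or> n = 1" using 0 by auto
  ultimately show ?case by (auto simp: arc_increment_def vpoint_def)
next
  case (Suc m)
  define k where "k = n div 5"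
  have k: "k < 2 * 5 ^ m" using Suc.prems unfolding k_def by simp
  have n: "n = 5 * k + n mod 5" unfolding k_def by simp
  have "\<bar>graph_laplacian (Suc m) u v\<bar> \<le> A / 15 ^ Suc m" if "v \<in> vertices (Suc m)" for v
    using A[OF that] by (simp add: pos_le_divide_eq mult.commute)
  then have "3 * \<bar>arc_increment u (Suc m) n\<bar> \<le> \<bar>arc_increment u m k\<bar> + 3 * (A / 15 ^ Suc m)"
    using arc_increment_refine[OF u k, of "n mod 5"] n by (metis mod_less_divisor zero_less_numeral)
  then have "3 ^ m * (3 * \<bar>arc_increment u (Suc m) n\<bar>) \<le>
      3 ^ m * (\<bar>arc_increment u m k\<bar> + 3 * (A / 15 ^ Suc m))"
    by (rule mult_left_mono) simp
  also have "\<dots> = 3 ^ m * \<bar>arc_increment u m k\<bar> + A / 5 ^ Suc m"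
  proof -
    have "(15::real) ^ Suc m = 3 ^ Suc m * 5 ^ Suc m"
      unfolding power_mult_distrib[symmetric] by simp
    then show ?thesis by (simp add: distrib_left)
  qed
  also have "\<dots> \<le> A / 4 * (1 - 1 / 5 ^ m) + A / 5 ^ Suc m"
    using Suc.IH[OF k] by simp
  also have "\<dots> = A / 4 * (1 - 1 / 5 ^ Suc m)" by (simp add: field_simps)
  finally show ?case by (simp add: mult_ac)
qed

section \<open>Triadic points of the central circle\<close>

text \<open>
  Reading the same digits in base 3 and in base 5 turns a triadic
  parameter \<open>k / 3^m\<close> into a point \<open>N / 5^m\<close> of the circle.
\<close>

fun digit_prefix :: "nat \<Rightarrow> (nat \<Rightarrow> nat) \<Rightarrow> nat \<Rightarrow> nat" where
  "digit_prefix b d 0 = 0"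
| "digit_prefix b d (Suc m) = b * digit_prefix b d m + d m"

lemma digit_prefix_cong:
  "(\<And>i. i < m \<Longrightarrow> d i = e i) \<Longrightarrow> digit_prefix b d m = digit_prefix b e m"
  by (induction m) auto

lemma sum_digits:
  assumes "b > 0"
  shows "(\<Sum>i<m. real (d i) / real b ^ Suc i) = real (digit_prefix b d m) / real b ^ m"
  using assms by (induction m) (auto simp: field_simps)

lemma ternaryD: "d \<in> ternary \<Longrightarrow> d i \<le> 2"
  by (auto simp: ternary_def dest!: spec[of _ i])

lemma digit_prefix_less:
  assumes "d \<in> ternary"
  shows "digit_prefix 3 d m < 3 ^ m" "2 * digit_prefix 5 d m < 5 ^ m"
proof -
  have "digit_prefix 3 d m + 1 \<le> 3 ^ m \<and> 2 * digit_prefix 5 d m + 1 \<le> 5 ^ m"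
  proof (induction m)
    case (Suc m)
    then show ?case using ternaryD[OF assms, of m] by auto
  qed simp
  then show "digit_prefix 3 d m < 3 ^ m" "2 * digit_prefix 5 d m < 5 ^ m" by auto
qed

lemma ex_digit_prefix: "k < 3 ^ m \<Longrightarrow> \<exists>d \<in> ternary. digit_prefix 3 d m = k"
proof (induction m arbitrary: k)
  case 0
  then show ?case by (auto simp: ternary_def intro!: exI[of _ "\<lambda>_. 0"])
next
  case (Suc m)
  then have "k div 3 < 3 ^ m" by simp
  then obtain d where d: "d \<in> ternary" "digit_prefix 3 d m = k div 3"
    using Suc.IH by blast
  have "digit_prefix 3 (d(m := k mod 3)) m = k div 3"
    using digit_prefix_cong[of m "d(m := k mod 3)" d] d(2) by auto
  then have "digit_prefix 3 (d(m := k mod 3)) (Suc m) = k" by simp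
  moreover have "d(m := k mod 3) \<in> ternary"
    using d(1) by (auto simp: ternary_def)
  ultimately show ?case by blast
qed

text \<open>
  Digits that are eventually \<open>c\<close> contribute the tail \<open>c / (b - 1) / b^m\<close>. For \<open>c = 2\<close> this is one
  unit of the last place in base 3, but only half a unit in base 5, which is the length of
  an arc of level \<open>m\<close>.
\<close>

lemma suminf_constant_tail:
  assumes "b > 1"
  shows "(\<Sum>i. real (if i < m then d i else c) / real b ^ Suc i) =
    real (digit_prefix b d m) / real b ^ m + real c / (real b - 1) / real b ^ m"
proof -
  have b: "real b > 1" using assms by simp
  let ?t = "\<lambda>i. real (if i < m then d i else c) / real b ^ Suc i"
  have "(\<lambda>i. (real c / real b ^ Suc m) * (1 / real b) ^ i) sums
      ((real c / real b ^ Suc m) * (1 / (1 - 1 / real b)))"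
    using b by (intro sums_mult geometric_sums) auto
  moreover have "(real c / real b ^ Suc m) * (1 / (1 - 1 / real b)) =
      real c / (real b - 1) / real b ^ m"
    using b by (simp add: field_simps)
  moreover have "(\<lambda>i. (real c / real b ^ Suc m) * (1 / real b) ^ i) = (\<lambda>i. ?t (i + m))"
    using b by (simp add: fun_eq_iff power_divide power_add mult_ac)
  ultimately have "(\<lambda>i. ?t (i + m)) sums (real c / (real b - 1) / real b ^ m)"
    by (simp only:)
  then have "?t sums (real c / (real b - 1) / real b ^ m + (\<Sum>i<m. ?t i))"
    by (subst (asm) sums_iff_shift[of ?t m])
  moreover have "(\<Sum>i<m. ?t i) = real (digit_prefix b d m) / real b ^ m"
    using sum_digits[of b d m] assms by simp
  ultimately show ?thesis using sums_unique by fastforce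
qed

lemma restrict_to_C_constant_tail:
  assumes u: "continuous_on_K u" and d: "d \<in> ternary" and c: "c \<in> {0, 1, 2}"
  shows "restrict_to_C u (real (digit_prefix 3 d m) / 3 ^ m + real c / 2 / 3 ^ m) =
    u (real (digit_prefix 5 d m) / 5 ^ m + real c / 4 / 5 ^ m)"
proof -
  have "(\<lambda>i. if i < m then d i else c) \<in> ternary"
    using d c by (auto simp: ternary_def)
  from restrict_to_C_eq[OF u this] show ?thesis
    using suminf_constant_tail[of 3 m d c] suminf_constant_tail[of 5 m d c] by simp
qed

text \<open>
  The left end of a triadic interval is reached by continuing its digits with zeros, and the right
  end by continuing the same digits with twos.
\<close>

lemma triadic_interval_is_arc:
  assumes u: "continuous_on_K u" and k: "k < 3 ^ m"
  obtains n where "n < 2 * 5 ^ m"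
    "restrict_to_C u (real (Suc k) / 3 ^ m) - restrict_to_C u (real k / 3 ^ m) = arc_increment u m n"
proof -
  obtain d where d: "d \<in> ternary" "digit_prefix 3 d m = k"
    using ex_digit_prefix[OF k] by blast
  let ?N = "digit_prefix 5 d m"
  have "restrict_to_C u (real k / 3 ^ m) = u (vpoint m (2 * ?N))"
    using restrict_to_C_constant_tail[OF u d(1), of 0 m] d(2) by (simp add: vpoint_def)
  moreover have "restrict_to_C u (real (Suc k) / 3 ^ m) = u (vpoint m (Suc (2 * ?N)))"
    using restrict_to_C_constant_tail[OF u d(1), of 2 m] d(2)
    by (simp add: vpoint_def add_divide_distrib add.commute)
  moreover have "2 * ?N < 2 * 5 ^ m" using digit_prefix_less(2)[OF d(1), of m] by simp
  ultimately show ?thesis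
    using that[of "2 * ?N"] unfolding arc_increment_def by simp
qed

section \<open>The Lipschitz estimate\<close>

lemma triadic_lipschitz:
  assumes u: "continuous_on_K u"
    and M: "\<And>m n. n < 2 * 5 ^ m \<Longrightarrow> 3 ^ m * \<bar>arc_increment u m n\<bar> \<le> M"
    and "k \<le> l" "l \<le> 3 ^ m"
  shows "\<bar>restrict_to_C u (real l / 3 ^ m) - restrict_to_C u (real k / 3 ^ m)\<bar>
    \<le> M * (real l / 3 ^ m - real k / 3 ^ m)"
  using assms(3,4)
proof (induction l rule: dec_induct)
  case (step l)
  then have "l < 3 ^ m" by simp
  then obtain n where n: "n < 2 * 5 ^ m"
    "restrict_to_C u (real (Suc l) / 3 ^ m) - restrict_to_C u (real l / 3 ^ m) = arc_increment u m n"
    by (rule triadic_interval_is_arc[OF u])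
  have "\<bar>arc_increment u m n\<bar> \<le> M / 3 ^ m"
    using M[OF n(1)] by (simp add: pos_le_divide_eq mult.commute)
  moreover have "M * (real (Suc l) / 3 ^ m - real k / 3 ^ m) =
      M * (real l / 3 ^ m - real k / 3 ^ m) + M / 3 ^ m"
    by (simp add: field_simps)
  ultimately show ?case using step n(2) by linarith
qed simp

text \<open>
  Truncation approximates the parameter and the point of the circle simultaneously, so
  that continuity of \<open>u\<close> on the circle yields convergence of the restricted values.
\<close>

lemma triadic_approximation:
  assumes u: "continuous_on_K u" and t: "t \<in> {0..1}"
  obtains k where "\<And>m. k m \<le> 3 ^ m" "(\<lambda>m. real (k m) / 3 ^ m) \<longlonglongrightarrow> t"
    "(\<lambda>m. restrict_to_C u (real (k m) / 3 ^ m)) \<longlonglongrightarrow> restrict_to_C u t"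
proof -
  obtain d where d: "d \<in> ternary" "t = (\<Sum>i. real (d i) / 3 ^ Suc i)"
    using ex_ternary[OF t] by blast
  have lim: "(\<lambda>m. real (digit_prefix b d m) / real b ^ m) \<longlonglongrightarrow> (\<Sum>i. real (d i) / real b ^ Suc i)"
    if "b > 1" for b
    using summable_LIMSEQ[OF summable_digits[OF d(1), of "real b"]] sum_digits[of b d] that
    by simp
  have "isCont u x" for x
    using u unfolding continuous_on_K_def by (simp add: continuous_on_eq_continuous_at)
  then have "(\<lambda>m. u (real (digit_prefix 5 d m) / 5 ^ m)) \<longlonglongrightarrow> u (\<Sum>i. real (d i) / 5 ^ Suc i)"
    using lim[of 5] by (intro isCont_tendsto_compose[of _ u]) auto
  moreover have "u (real (digit_prefix 5 d m) / 5 ^ m) =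
      restrict_to_C u (real (digit_prefix 3 d m) / 3 ^ m)" for m
    using restrict_to_C_constant_tail[OF u d(1), of 0 m] by simp
  ultimately have "(\<lambda>m. restrict_to_C u (real (digit_prefix 3 d m) / 3 ^ m)) \<longlonglongrightarrow> restrict_to_C u t"
    using restrict_to_C_eq[OF u d(1)] d(2) by simp
  then show ?thesis
    using that[of "digit_prefix 3 d"] digit_prefix_less(1)[OF d(1)] lim[of 3] d(2)
    by (simp add: less_imp_le)
qed

lemma lipschitz_restrict_to_C:
  assumes u: "continuous_on_K u"
    and M: "\<And>m n. n < 2 * 5 ^ m \<Longrightarrow> 3 ^ m * \<bar>arc_increment u m n\<bar> \<le> M"
  shows "M-lipschitz_on {0..1} (restrict_to_C u)"
proof (rule lipschitz_onI)
  show "0 \<le> M" using M[of 0 0] by simp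
  fix s t :: real
  assume s: "s \<in> {0..1}" and t: "t \<in> {0..1}"
  obtain k where k: "\<And>m. k m \<le> 3 ^ m" "(\<lambda>m. real (k m) / 3 ^ m) \<longlonglongrightarrow> s"
    "(\<lambda>m. restrict_to_C u (real (k m) / 3 ^ m)) \<longlonglongrightarrow> restrict_to_C u s"
    using triadic_approximation[OF u s] by blast
  obtain l where l: "\<And>m. l m \<le> 3 ^ m" "(\<lambda>m. real (l m) / 3 ^ m) \<longlonglongrightarrow> t"
    "(\<lambda>m. restrict_to_C u (real (l m) / 3 ^ m)) \<longlonglongrightarrow> restrict_to_C u t"
    using triadic_approximation[OF u t] by blast
  have grid: "\<bar>restrict_to_C u (real (k m) / 3 ^ m) - restrict_to_C u (real (l m) / 3 ^ m)\<bar>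
      \<le> M * \<bar>real (k m) / 3 ^ m - real (l m) / 3 ^ m\<bar>" for m
  proof (cases "k m \<le> l m")
    case True
    then have "real (k m) / 3 ^ m \<le> real (l m) / 3 ^ m" by (simp add: divide_right_mono)
    then show ?thesis
      using triadic_lipschitz[OF u M True l(1)] by (simp add: abs_minus_commute)
  next
    case False
    then have "l m \<le> k m" by simp
    moreover from this have "real (l m) / 3 ^ m \<le> real (k m) / 3 ^ m"
      by (simp add: divide_right_mono)
    ultimately show ?thesis
      using triadic_lipschitz[OF u M _ k(1)] by simp
  qed
  have "\<bar>restrict_to_C u s - restrict_to_C u t\<bar> \<le> M * \<bar>s - t\<bar>"
    by (rule LIMSEQ_le[OF tendsto_rabs[OF tendsto_diff[OF k(3) l(3)]]
          tendsto_mult_left[OF tendsto_rabs[OF tendsto_diff[OF k(2) l(2)]]]])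
      (use grid in blast)
  then show "dist (restrict_to_C u s) (restrict_to_C u t) \<le> M * dist s t"
    by (simp add: dist_real_def)
qed

theorem theorem4p1:
  fixes u :: "real \<Rightarrow> real" and \<mu> :: real
  assumes "eigenfunction u \<mu>"
  shows "\<exists>M. M-lipschitz_on {0..1} (restrict_to_C u)"
proof -
  obtain f where f: "has_laplacian u f" using assms unfolding eigenfunction_def by blast
  then have u: "continuous_on_K u" unfolding has_laplacian_def by blast
  obtain A where A: "\<And>m v. v \<in> vertices m \<Longrightarrow> 15 ^ m * \<bar>graph_laplacian m u v\<bar> \<le> A"
    using has_laplacian_bounded[OF f] by blast
  have "0 \<le> A"
  proof -
    obtain v where "v \<in> vertices 0" using vertices_nonempty by blast
    from A[OF this] show ?thesis by (simp add: order_trans[OF abs_ge_zero])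
  qed
  then have "A / 4 * (1 - 1 / 5 ^ m) \<le> A / 4" for m
    by (intro mult_left_le) auto
  then have "3 ^ m * \<bar>arc_increment u m n\<bar> \<le> A / 4" if "n < 2 * 5 ^ m" for m n
    using arc_increment_bound[OF u A that] order_trans by blast
  from lipschitz_restrict_to_C[OF u this] show ?thesis by blast
qed

end
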